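(* Let $T_1$ and $T_2$ be tournaments such that $T_1$ is switching isomorphic to $T_2$. Then (i) $T_1$ is a CR tournament if and only if $T_2$ is a CR tournament; (ii) $T_1$ is a strong CR tournament if and only if $T_2$ is a strong CR tournament; (iii) $T_1$ is a basic tournament if and only if $T_2$ is a basic tournament; (iv) $T_1$ is a basic CR tournament if and only if $T_2$ is a basic CR tournament; (v) $T_1$ is a basic strong CR tournament if and only if $T_2$ is a basic strong CR tournament.
   Context: A tournament is a digraph with exactly one arc between each pair of distinct vertices. For distinct vertices write $\theta_T(u,v)=1$ if $u\to v$, $-1$ otherwise. Skew-adjacency matrix $S_T$: entry $1$ if $v_i\to v_j$, $-1$ if $v_j\to v_i$, $0$ on the diagonal; $\det(T)=\det(S_T)$. For odd $k\ge1$, $\mathcal{D}_k$ is the set of tournaments all of whose induced subtournaments have determinant at most $k^2$; $\mathcal{D}_{-1}=\emptyset$. The switch of $T$ w.r.t. $W\subseteq V(T)$ reverses all arcs between $W$ and $V(T)\setminus W$; $T_1$ is switching isomorphic to $T_2$ if some switch of $T_1$ is isomorphic to $T_2$. A diamond is a 4-tournament consisting of a 3-cycle plus a vertex dominating all of it or dominated by all of it. A 1-transitive blowup of $T$ (vertices $v_1,\dots,v_n$) is obtained by replacing one vertex $v_i$ by two vertices $x\to y$, each having the same relation to every $v_j$ ($j\ne i$) as $v_i$ had. Two vertices $u_1,u_2$ of $T$ are covertices and revertices if $|V(T)|=2$; if $|V(T)|\ge3$ they are covertices if $\theta_T(u_1,v)=\theta_T(u_2,v)$ for all other $v$, revertices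 if $\theta_T(u_1,v)=-\theta_T(u_2,v)$ for all other $v$; CR-associated if covertices or revertices. For $u\notin V(T)=\{w_1,\dots,w_n\}$ and $\sigma=(r_1,\dots,r_n)\in\{\pm1\}^n$, $T(u,\sigma)$ extends $T$ by $u$ with $u\to w_i$ iff $r_i=1$; $u$ is a CR vertex for $T$ with $\sigma$ if $u$ is CR-associated in $T(u,\sigma)$ with some vertex of $T$, otherwise a non-CR vertex. Let $T\in\mathcal{D}_k\setminus\mathcal{D}_{k-2}$ for some odd $k$. $T$ is a CR tournament if $T$ is a 1-tournament, a 2-tournament or a diamond, or else for every $u\notin V(T)$ and every $\sigma$ with $u$ a non-CR vertex for $T$ with $\sigma$, $T(u,\sigma)\notin\mathcal{D}_k$. A strong CR tournament is a CR tournament all of whose 1-transitive blowups are CR tournaments. A tournament of order at least $4$ is basic if no two of its vertices are CR-associated; a basic (strong) CR tournament is a basic tournament that is a (strong) CR tournament. *)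

theory Defs
  imports
    "HOL-Library.FuncSet"
    "HOL-Library.Infinite_Typeclass"
    "Graph_Theory.Pair_Digraph"
    "Graph_Theory.Digraph_Isomorphism"
    "Jordan_Normal_Form.Determinant"
begin

locale tournament = pair_digraph T for T :: "'a pair_pre_digraph" +
  assumes exactly_one_arc:
    "\<lbrakk>u \<in> pverts T; v \<in> pverts T; u \<noteq> v\<rbrakk> \<Longrightarrow> (u, v) \<in> parcs T \<longleftrightarrow> (v, u) \<notin> parcs T"

definition theta :: "'a pair_pre_digraph \<Rightarrow> 'a \<Rightarrow> 'a \<Rightarrow> int" where
  "theta T u v = (if (u, v) \<in> parcs T then 1 else -1)"

definition skew_adjacency_mat :: "'a pair_pre_digraph \<Rightarrow> 'a list \<Rightarrow> int mat" where
  "skew_adjacency_mat T vs = mat (length vs) (length vs) (\<lambda>(i, j).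
     if (vs ! i, vs ! j) \<in> parcs T then 1 else if (vs ! j, vs ! i) \<in> parcs T then -1 else 0)"

text \<open>The choice of the vertex enumeration is immaterial, see \<open>tournament_det_eq\<close> below.\<close>

definition tournament_det :: "'a pair_pre_digraph \<Rightarrow> int" where
  "tournament_det T = det (skew_adjacency_mat T (SOME vs. distinct vs \<and> set vs = pverts T))"

lemma det_skew_adjacency_mat_perm:
  assumes "mset ws = mset vs"
  shows "det (skew_adjacency_mat T ws) = det (skew_adjacency_mat T vs)"
proof -
  obtain p where p': "p permutes {..<length vs}" and ws: "permute_list p vs = ws"
    using mset_eq_permutation[OF assms] .
  let ?n = "length vs"
  define f where "f x y = (if (x, y) \<in> parcs T then 1 else if (y, x) \<in> parcs T then -1 else 0 :: int)"
    for x y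
  have p: "p permutes {0..<?n}" using p' by (simp add: atLeast0LessThan)
  have pi: "p i < ?n" if "i < ?n" for i using permutes_in_image[OF p, of i] that by auto
  have len: "length ws = ?n" using ws by auto
  have nth: "ws ! i = vs ! p i" if "i < ?n" for i
    using permute_list_nth[OF p' that] ws by simp
  define A where "A = skew_adjacency_mat T vs"
  define B where "B = mat ?n ?n (\<lambda>(i, j). transpose_mat A $$ (p i, j))"
  have A: "A \<in> carrier_mat ?n ?n" by (simp add: A_def skew_adjacency_mat_def)
  have B: "B \<in> carrier_mat ?n ?n" by (simp add: B_def)
  have Aij: "A $$ (i, j) = f (vs ! i) (vs ! j)" if "i < ?n" "j < ?n" for i j
    using that by (simp add: A_def skew_adjacency_mat_def f_def)
  have eq: "skew_adjacency_mat T ws = mat ?n ?n (\<lambda>(i, j). transpose_mat B $$ (p i, j))"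
    by (rule eq_matI)
      (use A B in \<open>auto simp: skew_adjacency_mat_def len nth pi B_def Aij f_def\<close>)
  have "det (skew_adjacency_mat T ws) = signof p * det (transpose_mat B)"
    unfolding eq by (rule det_permute_rows) (use B p in auto)
  also have "det (transpose_mat B) = det B" by (rule det_transpose[OF B])
  also have "det B = signof p * det (transpose_mat A)"
    unfolding B_def by (rule det_permute_rows) (use A p in auto)
  also have "det (transpose_mat A) = det A" by (rule det_transpose[OF A])
  finally show ?thesis by (simp add: A_def sign_def)
qed

lemma tournament_det_eq:
  assumes "distinct vs" "set vs = pverts T"
  shows "tournament_det T = det (skew_adjacency_mat T vs)"
proof -
  let ?ws = "SOME ws. distinct ws \<and> set ws = pverts T"
  have "distinct ?ws \<and> set ?ws = pverts T"
    by (rule someI[of _ vs]) (use assms in simp)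
  then have "mset ?ws = mset vs"
    using assms by (simp add: set_eq_iff_mset_eq_distinct[symmetric])
  then show ?thesis unfolding tournament_det_def by (rule det_skew_adjacency_mat_perm)
qed

text \<open>Only used for odd \<open>k \<ge> -1\<close>; the condition \<open>1 \<le> k\<close> makes the class empty for \<open>k = -1\<close>.\<close>

definition det_class :: "int \<Rightarrow> 'a pair_pre_digraph set" where
  "det_class k = {T. tournament T \<and> 1 \<le> k \<and>
     (\<forall>H. induced_subgraph (with_proj H) (with_proj T) \<longrightarrow> tournament_det H \<le> k\<^sup>2)}"

definition switch :: "'a pair_pre_digraph \<Rightarrow> 'a set \<Rightarrow> 'a pair_pre_digraph" where
  "switch T W = \<lparr>pverts = pverts T,
     parcs = {(x, y). if x \<in> W \<longleftrightarrow> y \<in> W then (x, y) \<in> parcs T else (y, x) \<in> parcs T}\<rparr>"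

definition switching_isomorphic :: "'a pair_pre_digraph \<Rightarrow> 'b pair_pre_digraph \<Rightarrow> bool" where
  "switching_isomorphic T1 T2 \<longleftrightarrow>
     (\<exists>W \<subseteq> pverts T1. digraph_iso (with_proj (switch T1 W)) (with_proj T2))"

definition diamond :: "'a pair_pre_digraph \<Rightarrow> bool" where
  "diamond T \<longleftrightarrow> tournament T \<and> (\<exists>a b c d. distinct [a, b, c, d] \<and> pverts T = {a, b, c, d} \<and>
     {(a, b), (b, c), (c, a)} \<subseteq> parcs T \<and>
     ({(d, a), (d, b), (d, c)} \<subseteq> parcs T \<or> {(a, d), (b, d), (c, d)} \<subseteq> parcs T))"

definition covertices :: "'a pair_pre_digraph \<Rightarrow> 'a \<Rightarrow> 'a \<Rightarrow> bool" where
  "covertices T u1 u2 \<longleftrightarrow> u1 \<in> pverts T \<and> u2 \<in> pverts T \<and> u1 \<noteq> u2 \<and>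
     (card (pverts T) = 2 \<or> (\<forall>v \<in> pverts T - {u1, u2}. theta T u1 v = theta T u2 v))"

definition revertices :: "'a pair_pre_digraph \<Rightarrow> 'a \<Rightarrow> 'a \<Rightarrow> bool" where
  "revertices T u1 u2 \<longleftrightarrow> u1 \<in> pverts T \<and> u2 \<in> pverts T \<and> u1 \<noteq> u2 \<and>
     (card (pverts T) = 2 \<or> (\<forall>v \<in> pverts T - {u1, u2}. theta T u1 v = - theta T u2 v))"

definition cr_associated :: "'a pair_pre_digraph \<Rightarrow> 'a \<Rightarrow> 'a \<Rightarrow> bool" where
  "cr_associated T u1 u2 \<longleftrightarrow> covertices T u1 u2 \<or> revertices T u1 u2"

text \<open>The sign vector \<open>\<sigma>\<close> is indexed by the vertices themselves.\<close>

definition extend :: "'a pair_pre_digraph \<Rightarrow> 'a \<Rightarrow> ('a \<Rightarrow> int) \<Rightarrow> 'a pair_pre_digraph" where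
  "extend T u \<sigma> = \<lparr>pverts = insert u (pverts T),
     parcs = parcs T \<union> {(u, w) | w. w \<in> pverts T \<and> \<sigma> w = 1}
                     \<union> {(w, u) | w. w \<in> pverts T \<and> \<sigma> w \<noteq> 1}\<rparr>"

definition cr_vertex :: "'a pair_pre_digraph \<Rightarrow> 'a \<Rightarrow> ('a \<Rightarrow> int) \<Rightarrow> bool" where
  "cr_vertex T u \<sigma> \<longleftrightarrow> (\<exists>w \<in> pverts T. cr_associated (extend T u \<sigma>) u w)"

text \<open>New vertices are drawn from the vertex type itself; requiring it to be infinite guarantees
  that the quantifiers over new vertices are never vacuous.\<close>

definition cr_tournament :: "'a::infinite pair_pre_digraph \<Rightarrow> bool" where
  "cr_tournament T \<longleftrightarrow> (\<exists>k. odd k \<and> T \<in> det_class k - det_class (k - 2) \<and>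
     (card (pverts T) = 1 \<or> card (pverts T) = 2 \<or> diamond T \<or>
      (\<forall>u \<sigma>. u \<notin> pverts T \<longrightarrow> \<sigma> \<in> pverts T \<rightarrow> {-1, 1} \<longrightarrow>
         \<not> cr_vertex T u \<sigma> \<longrightarrow> extend T u \<sigma> \<notin> det_class k)))"

definition one_transitive_blowup ::
  "'a::infinite pair_pre_digraph \<Rightarrow> 'a pair_pre_digraph \<Rightarrow> bool" where
  "one_transitive_blowup T T' \<longleftrightarrow>
     (\<exists>v \<in> pverts T. \<exists>x y. x \<noteq> y \<and> x \<notin> pverts T - {v} \<and> y \<notin> pverts T - {v} \<and>
        T' = \<lparr>pverts = (pverts T - {v}) \<union> {x, y},
              parcs = {(a, b). (a, b) \<in> parcs T \<and> a \<noteq> v \<and> b \<noteq> v} \<union> {(x, y)}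
                \<union> {(z, w) | z w. z \<in> {x, y} \<and> (v, w) \<in> parcs T}
                \<union> {(w, z) | z w. z \<in> {x, y} \<and> (w, v) \<in> parcs T}\<rparr>)"

definition strong_cr_tournament :: "'a::infinite pair_pre_digraph \<Rightarrow> bool" where
  "strong_cr_tournament T \<longleftrightarrow>
     cr_tournament T \<and> (\<forall>T'. one_transitive_blowup T T' \<longrightarrow> cr_tournament T')"

definition basic_tournament :: "'a pair_pre_digraph \<Rightarrow> bool" where
  "basic_tournament T \<longleftrightarrow> tournament T \<and> 4 \<le> card (pverts T) \<and>
     \<not> (\<exists>u \<in> pverts T. \<exists>v \<in> pverts T. u \<noteq> v \<and> cr_associated T u v)"

definition basic_cr_tournament :: "'a::infinite pair_pre_digraph \<Rightarrow> bool" where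
  "basic_cr_tournament T \<longleftrightarrow> basic_tournament T \<and> cr_tournament T"

definition basic_strong_cr_tournament :: "'a::infinite pair_pre_digraph \<Rightarrow> bool" where
  "basic_strong_cr_tournament T \<longleftrightarrow> basic_tournament T \<and> strong_cr_tournament T"

end

theory Submission
  imports Defs
begin

text \<open>A switching isomorphism \<open>f\<close> with switching set \<open>W\<close> satisfies
  \<open>\<theta>(f x, f y) = s x * s y * \<theta>(x, y)\<close>, where \<open>s\<close> is \<open>-1\<close> on \<open>W\<close> and \<open>1\<close> elsewhere. So it
  conjugates the skew-adjacency matrix by a signed permutation matrix and preserves all
  subdeterminants, and it maps CR-associated pairs to CR-associated pairs, interchanging covertices
  and revertices when \<open>s\<close> differs on the pair. Every one-vertex extension and every
  1-transitive blowup on one side is matched by one on the other side along an extension of the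
  map: for extensions the sign vector is multiplied by \<open>s\<close>, for blowups both copies inherit the
  sign of the replaced vertex.\<close>

section \<open>Switching maps between tournaments\<close>

text \<open>Only the values of \<open>f\<close> and \<open>W\<close> on \<open>pverts T1\<close> are
  constrained. Hence the same \<open>f\<close> and \<open>W\<close> can be reused on any induced
  subtournament, and \<open>W\<close> may contain points outside the tournament.\<close>

definition switching_map ::
  "('a \<Rightarrow> 'b) \<Rightarrow> 'a set \<Rightarrow> 'a pair_pre_digraph \<Rightarrow> 'b pair_pre_digraph \<Rightarrow> bool" where
  "switching_map f W T1 T2 \<longleftrightarrow> tournament T1 \<and> tournament T2 \<and>
     bij_betw f (pverts T1) (pverts T2) \<and>
     (\<forall>x \<in> pverts T1. \<forall>y \<in> pverts T1. (f x, f y) \<in> parcs T2 \<longleftrightarrow>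
        (if x \<in> W \<longleftrightarrow> y \<in> W then (x, y) \<in> parcs T1 else (y, x) \<in> parcs T1))"

text \<open>Trades the locale for plain conditions on vertex set and arc relation. Finiteness of the
  arc set follows from that of the vertex set, and absence of loops from asymmetry.\<close>

lemma tournament_iff:
  "tournament T \<longleftrightarrow> finite (pverts T) \<and> parcs T \<subseteq> pverts T \<times> pverts T \<and>
     asym (parcs T) \<and> total_on (pverts T) (parcs T)"
  (is "_ \<longleftrightarrow> ?R")
proof
  assume "tournament T"
  then interpret tournament T .
  have "parcs T \<subseteq> pverts T \<times> pverts T" by (auto dest: in_arcsD1 in_arcsD2)
  moreover have "asym (parcs T)"
    using exactly_one_arc no_loops' in_arcsD1 in_arcsD2 by (metis asymI)
  moreover have "total_on (pverts T) (parcs T)"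
    using exactly_one_arc by (metis total_onI)
  ultimately show ?R using pair_finite_verts by blast
next
  assume R: ?R
  then have fin: "finite (parcs T)" by (meson finite_SigmaI finite_subset)
  have loop: "fst e \<noteq> snd e" if "e \<in> parcs T" for e
    using R that by (metis asymD prod.collapse)
  show "tournament T"
  proof unfold_locales
    show "(u, v) \<in> parcs T \<longleftrightarrow> (v, u) \<notin> parcs T"
      if "u \<in> pverts T" "v \<in> pverts T" "u \<noteq> v" for u v
      using R that by (metis asymD total_on_def)
  qed (use R fin loop in auto)
qed

lemma tournament_finite: "tournament T \<Longrightarrow> finite (pverts T)"
  and tournament_parcs_subset: "tournament T \<Longrightarrow> parcs T \<subseteq> pverts T \<times> pverts T"
  by (simp_all add: tournament_iff)

lemma tournament_no_loop: "tournament T \<Longrightarrow> (u, u) \<notin> parcs T"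
  by (auto simp: tournament_iff dest: asymD)

lemma tournament_arc_iff:
  assumes "tournament T" "u \<in> pverts T" "v \<in> pverts T"
  shows "(u, v) \<in> parcs T \<longleftrightarrow> u \<noteq> v \<and> (v, u) \<notin> parcs T"
  using assms unfolding tournament_iff by (metis asymD total_on_def)

text \<open>The single equivalence yields asymmetry, totality and, for \<open>u = v\<close>, absence
  of loops. It is the form in which induced subtournaments, extensions and blowups are
  checked.\<close>

lemma tournamentI:
  assumes "finite (pverts T)" "parcs T \<subseteq> pverts T \<times> pverts T"
    and "\<And>u v. u \<in> pverts T \<Longrightarrow> v \<in> pverts T \<Longrightarrow> (u, v) \<in> parcs T \<longleftrightarrow> u \<noteq> v \<and> (v, u) \<notin> parcs T"
  shows "tournament T"
proof -
  have "asym (parcs T)" using assms(2,3) by (intro asymI) blast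
  moreover have "total_on (pverts T) (parcs T)" using assms(3) by (metis total_onI)
  ultimately show ?thesis using assms(1,2) by (simp add: tournament_iff)
qed

lemma switching_mapD:
  assumes "switching_map f W T1 T2"
  shows "tournament T1" "tournament T2" "bij_betw f (pverts T1) (pverts T2)"
    and "f ` pverts T1 = pverts T2" "inj_on f (pverts T1)"
    and "\<And>x y. x \<in> pverts T1 \<Longrightarrow> y \<in> pverts T1 \<Longrightarrow> (f x, f y) \<in> parcs T2 \<longleftrightarrow>
          (if x \<in> W \<longleftrightarrow> y \<in> W then (x, y) \<in> parcs T1 else (y, x) \<in> parcs T1)"
  using assms by (auto simp: switching_map_def bij_betw_def)

lemma switching_isomorphic_imp_switching_map:
  assumes "tournament T1" "tournament T2" "switching_isomorphic T1 T2"
  obtains f W where "switching_map f W T1 T2"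
proof -
  obtain W h where h: "pre_digraph.digraph_isomorphism (with_proj (switch T1 W)) h"
    and T2: "with_proj T2 = app_iso h (with_proj (switch T1 W))"
    using assms(3) by (auto simp: switching_isomorphic_def digraph_iso_def)
  let ?S = "switch T1 W" and ?f = "iso_verts h"
  have V2: "pverts T2 = ?f ` pverts T1"
    using arg_cong[OF T2, of verts] by (simp add: switch_def)
  have A2: "parcs T2 = iso_arcs h ` parcs ?S"
    using arg_cong[OF T2, of arcs] by simp
  \<comment> \<open>On the \<open>T2\<close> side tail and head are the pair projections, so the arc
    part of \<open>h\<close> is forced by its vertex part. This lets the vertex map alone carry all
    the information.\<close>
  have tail: "fst = iso_tail h" and head: "snd = iso_head h"
    using arg_cong[OF T2, of tail] arg_cong[OF T2, of head] by simp_all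
  have inj: "inj_on ?f (pverts T1)"
    using h by (simp add: pre_digraph.digraph_isomorphism_def switch_def)
  have arc: "iso_arcs h (x, y) = (?f x, ?f y)" if "(x, y) \<in> parcs ?S" for x y
    using h that by (auto simp: pre_digraph.digraph_isomorphism_def tail[symmetric]
        head[symmetric] intro!: prod_eqI)
  have S_sub: "parcs ?S \<subseteq> pverts T1 \<times> pverts T1"
    using tournament_parcs_subset[OF assms(1)] by (auto simp: switch_def split: if_splits)
  have "(?f x, ?f y) \<in> parcs T2 \<longleftrightarrow> (x, y) \<in> parcs ?S"
    if xy: "x \<in> pverts T1" "y \<in> pverts T1" for x y
  proof
    assume "(?f x, ?f y) \<in> parcs T2"
    then obtain x' y' where "(x', y') \<in> parcs ?S" "(?f x, ?f y) = (?f x', ?f y')"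
      unfolding A2 using arc by auto
    moreover from this(1) have "x' \<in> pverts T1" "y' \<in> pverts T1" using S_sub by auto
    ultimately show "(x, y) \<in> parcs ?S" using inj xy by (simp add: inj_on_eq_iff)
  next
    assume "(x, y) \<in> parcs ?S"
    then show "(?f x, ?f y) \<in> parcs T2" unfolding A2 using arc image_eqI by metis
  qed
  then have "switching_map ?f W T1 T2"
    using assms V2 inj by (auto simp: switching_map_def bij_betw_def switch_def)
  then show thesis by (rule that)
qed

text \<open>Switching is an involution, so the inverse bijection is again a switching map, for the
  transported set. \<open>W\<close> is cut down to \<open>pverts T1\<close> first, because the image
  of a point outside could coincide with that of a vertex not in \<open>W\<close>. With this,
  one-sided transfer lemmas suffice.\<close>

lemma switching_map_inverse:
  assumes "switching_map f W T1 T2"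
  shows "switching_map (the_inv_into (pverts T1) f) (f ` (W \<inter> pverts T1)) T2 T1"
proof -
  note D = switching_mapD[OF assms]
  let ?g = "the_inv_into (pverts T1) f"
  have gf: "?g (f x) = x" if "x \<in> pverts T1" for x
    using D(5) that by (simp add: the_inv_into_f_f)
  have mem: "f x \<in> f ` (W \<inter> pverts T1) \<longleftrightarrow> x \<in> W" if "x \<in> pverts T1" for x
    using D(5) that by (auto dest: inj_onD)
  have "(?g x', ?g y') \<in> parcs T1 \<longleftrightarrow>
      (if x' \<in> f ` (W \<inter> pverts T1) \<longleftrightarrow> y' \<in> f ` (W \<inter> pverts T1)
       then (x', y') \<in> parcs T2 else (y', x') \<in> parcs T2)"
    if xy': "x' \<in> pverts T2" "y' \<in> pverts T2" for x' y'
  proof -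
    obtain x y where xy: "x \<in> pverts T1" "y \<in> pverts T1" "x' = f x" "y' = f y"
      using xy' D(4) by blast
    show ?thesis
      using D(6)[OF xy(1,2)] D(6)[OF xy(2,1)] xy by (simp add: gf mem)
  qed
  then show ?thesis unfolding switching_map_def
    using D(1,2) bij_betw_the_inv_into[OF D(3)] by blast
qed

section \<open>Signs and CR-association\<close>

lemma switching_map_theta:
  assumes "switching_map f W T1 T2" "x \<in> pverts T1" "y \<in> pverts T1" "x \<noteq> y"
  shows "theta T2 (f x) (f y) = (if x \<in> W \<longleftrightarrow> y \<in> W then theta T1 x y else - theta T1 x y)"
  using switching_mapD(6)[OF assms(1-3)] tournament_arc_iff[OF switching_mapD(1)[OF assms(1)] assms(2,3)]
    assms(4)
  by (auto simp: theta_def)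

text \<open>For a third vertex \<open>w\<close>, the sign of \<open>w\<close> enters both values of
  \<open>theta\<close> and cancels from their comparison. What remains is the product of the signs
  of \<open>u\<close> and \<open>v\<close>, which does not depend on \<open>w\<close>.\<close>

lemma switching_map_cr_associated:
  assumes m: "switching_map f W T1 T2" and u: "u \<in> pverts T1" and v: "v \<in> pverts T1"
  shows "cr_associated T2 (f u) (f v) \<longleftrightarrow> cr_associated T1 u v"
proof -
  note D = switching_mapD[OF m]
  have card: "card (pverts T2) = card (pverts T1)"
    using bij_betw_same_card[OF D(3)] by simp
  have diff: "pverts T2 - {f u, f v} = f ` (pverts T1 - {u, v})"
    using D(4,5) u v by (auto dest: inj_onD)
  have neq: "f u = f v \<longleftrightarrow> u = v" using D(5) u v by (auto dest: inj_onD)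
  have mem: "f u \<in> pverts T2" "f v \<in> pverts T2" using D(4) u v by auto
  have th: "theta T2 (f z) (f w) = (if z \<in> W \<longleftrightarrow> w \<in> W then theta T1 z w else - theta T1 z w)"
    if "z \<in> {u, v}" "w \<in> pverts T1 - {u, v}" for z w
    using switching_map_theta[OF m, of z w] that u v by auto
  have co: "(\<forall>w \<in> pverts T2 - {f u, f v}. theta T2 (f u) w = theta T2 (f v) w) \<longleftrightarrow>
      (\<forall>w \<in> pverts T1 - {u, v}. theta T1 u w =
         (if u \<in> W \<longleftrightarrow> v \<in> W then theta T1 v w else - theta T1 v w))"
    unfolding diff ball_simps by (intro ball_cong refl) (auto simp: th)
  have re: "(\<forall>w \<in> pverts T2 - {f u, f v}. theta T2 (f u) w = - theta T2 (f v) w) \<longleftrightarrow>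
      (\<forall>w \<in> pverts T1 - {u, v}. theta T1 u w =
         (if u \<in> W \<longleftrightarrow> v \<in> W then - theta T1 v w else theta T1 v w))"
    unfolding diff ball_simps by (intro ball_cong refl) (auto simp: th)
  show ?thesis
    unfolding cr_associated_def covertices_def revertices_def co re card neq
    using u v mem by (cases "u \<in> W \<longleftrightarrow> v \<in> W") (simp_all, blast+)
qed

section \<open>Determinants and the classes \<open>det_class k\<close>\<close>

text \<open>In the Leibniz formula every permutation picks each \<open>s i\<close> once as a row
  sign and once as a column sign, so each summand only gains the factor
  \<open>(\<Prod>i = 0..<n. s i * s i) = 1\<close>.\<close>

lemma det_sign_conjugate:
  fixes s :: "nat \<Rightarrow> 'a::comm_ring_1"
  assumes A: "A \<in> carrier_mat n n" and s: "\<And>i. i < n \<Longrightarrow> s i * s i = 1"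
  shows "det (mat n n (\<lambda>(i, j). s i * s j * A $$ (i, j))) = det A"
proof -
  let ?B = "mat n n (\<lambda>(i, j). s i * s j * A $$ (i, j))"
  have "(\<Prod>i = 0..<n. ?B $$ (i, p i)) = (\<Prod>i = 0..<n. A $$ (i, p i))"
    if p: "p permutes {0..<n}" for p
  proof -
    have "p i < n" if "i < n" for i using permutes_in_image[OF p, of i] that by simp
    then have "(\<Prod>i = 0..<n. ?B $$ (i, p i)) = (\<Prod>i = 0..<n. s i * s (p i) * A $$ (i, p i))"
      by (intro prod.cong) auto
    also have "\<dots> = (\<Prod>i = 0..<n. s i) * (\<Prod>i = 0..<n. s (p i)) * (\<Prod>i = 0..<n. A $$ (i, p i))"
      by (simp add: prod.distrib)
    also have "(\<Prod>i = 0..<n. s (p i)) = (\<Prod>i = 0..<n. s i)"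
      using prod.permute[OF p, of s] by (simp add: o_def)
    also have "(\<Prod>i = 0..<n. s i) * (\<Prod>i = 0..<n. s i) = 1"
      by (simp add: prod.distrib[symmetric] s)
    finally show ?thesis by simp
  qed
  then show ?thesis
    by (simp add: det_def'[OF A] det_def'[of ?B n])
qed

text \<open>Enumerating \<open>T2\<close> by the \<open>f\<close>-images of an enumeration of
  \<open>T1\<close> absorbs the bijection, so the two matrices differ by signs alone.\<close>

lemma switching_map_det:
  assumes m: "switching_map f W T1 T2"
  shows "tournament_det T2 = tournament_det T1"
proof -
  note D = switching_mapD[OF m]
  obtain vs where vs: "set vs = pverts T1" "distinct vs"
    using finite_distinct_list tournament_finite[OF D(1)] by blast
  let ?n = "length vs" and ?A = "skew_adjacency_mat T1 vs"
  define s :: "nat \<Rightarrow> int" where "s i = (if vs ! i \<in> W then -1 else 1)" for i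
  have vi: "vs ! i \<in> pverts T1" if "i < ?n" for i using nth_mem[OF that] vs(1) by simp
  have "skew_adjacency_mat T2 (map f vs) = mat ?n ?n (\<lambda>(i, j). s i * s j * ?A $$ (i, j))"
  proof (rule eq_matI, goal_cases)
    case (1 i j)
    then have ij: "i < ?n" "j < ?n" by simp_all
    note vij = vi[OF ij(1)] vi[OF ij(2)]
    \<comment> \<open>The matrix entry tests the arc \<open>(i, j)\<close> before
      \<open>(j, i)\<close>; reversing an arc negates the entry only because both tests cannot
      succeed.\<close>
    have "\<not> ((vs ! i, vs ! j) \<in> parcs T1 \<and> (vs ! j, vs ! i) \<in> parcs T1)"
      using tournament_arc_iff[OF D(1) vij] by blast
    then show ?case
      using ij D(6)[OF vij] D(6)[OF vij(2,1)]
      by (cases "vs ! i \<in> W"; cases "vs ! j \<in> W") (simp_all add: skew_adjacency_mat_def s_def)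
  qed (simp_all add: skew_adjacency_mat_def)
  moreover have "det (mat ?n ?n (\<lambda>(i, j). s i * s j * ?A $$ (i, j))) = det ?A"
    by (rule det_sign_conjugate) (auto simp: skew_adjacency_mat_def s_def)
  moreover have "tournament_det T2 = det (skew_adjacency_mat T2 (map f vs))"
    by (rule tournament_det_eq) (use vs D in \<open>auto simp: distinct_map\<close>)
  moreover have "tournament_det T1 = det ?A"
    using vs by (intro tournament_det_eq) auto
  ultimately show ?thesis by simp
qed

text \<open>Tail and head are \<open>fst\<close> and \<open>snd\<close> on both sides, so
  compatibility is automatic, and the equation for the arcs makes \<open>H\<close>
  well-formed.\<close>

lemma induced_subgraph_with_proj_iff:
  assumes "tournament T"
  shows "induced_subgraph (with_proj H) (with_proj T) \<longleftrightarrow>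
    pverts H \<subseteq> pverts T \<and> parcs H = parcs T \<inter> (pverts H \<times> pverts H)"
proof -
  have "pair_wf_digraph T" using tournament_parcs_subset[OF assms] by unfold_locales auto
  moreover have "pair_wf_digraph H" if "parcs H = parcs T \<inter> (pverts H \<times> pverts H)"
    using that by unfold_locales (simp_all add: mem_Times_iff)
  ultimately show ?thesis
    by (auto simp: induced_subgraph_def subgraph_def wf_digraph_wp_iff)
qed

lemma tournament_induced:
  assumes "tournament T" "pverts H \<subseteq> pverts T" "parcs H = parcs T \<inter> (pverts H \<times> pverts H)"
  shows "tournament H"
proof (rule tournamentI)
  show "finite (pverts H)" using assms(1,2) tournament_finite finite_subset by blast
qed (use assms tournament_arc_iff[OF assms(1)] in blast)+

text \<open>An induced subtournament of \<open>T2\<close> is pulled back to its preimage in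
  \<open>T1\<close>. There \<open>f\<close> and \<open>W\<close> still give a switching map, so both
  have the same determinant.\<close>

lemma switching_map_det_class_imp:
  assumes m: "switching_map f W T1 T2" and k: "T1 \<in> det_class k"
  shows "T2 \<in> det_class k"
proof -
  note D = switching_mapD[OF m]
  have "tournament_det H \<le> k\<^sup>2" if "induced_subgraph (with_proj H) (with_proj T2)" for H
  proof -
    have H: "pverts H \<subseteq> pverts T2" "parcs H = parcs T2 \<inter> (pverts H \<times> pverts H)"
      using that induced_subgraph_with_proj_iff[OF D(2)] by auto
    define U where "U = {x \<in> pverts T1. f x \<in> pverts H}"
    let ?H = "\<lparr>pverts = U, parcs = parcs T1 \<inter> (U \<times> U)\<rparr>"
    have U: "U \<subseteq> pverts T1" "f ` U = pverts H" using H(1) D(4) by (auto simp: U_def)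
    have "tournament ?H" using tournament_induced[OF D(1), of ?H] U(1) by simp
    moreover have "tournament H" using tournament_induced[OF D(2) H] .
    moreover have "inj_on f U" using D(5) U(1) by (rule inj_on_subset)
    ultimately have "switching_map f W ?H H"
      unfolding switching_map_def using U D(6) H(2)
      by (auto simp: bij_betw_def subset_eq)
    then have "tournament_det H = tournament_det ?H" by (rule switching_map_det)
    moreover have "induced_subgraph (with_proj ?H) (with_proj T1)"
      using induced_subgraph_with_proj_iff[OF D(1), of ?H] U(1) by simp
    ultimately show ?thesis using k by (simp add: det_class_def)
  qed
  then show ?thesis using k D(2) by (simp add: det_class_def)
qed

lemma switching_map_det_class:
  assumes "switching_map f W T1 T2"
  shows "T2 \<in> det_class k \<longleftrightarrow> T1 \<in> det_class k"
  using assms switching_map_inverse switching_map_det_class_imp by metis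

section \<open>Diamonds\<close>

text \<open>Diamonds form a separate alternative in \<open>cr_tournament\<close>, so this
  alternative must be transferred as well. A switch may turn another vertex into the apex, which is
  why the image cannot be described by a fixed labelling.\<close>

lemma switching_map_diamond:
  assumes m: "switching_map f W T1 T2" and "diamond T1"
  shows "diamond T2"
proof -
  note D = switching_mapD[OF m]
  obtain a b c d where dist: "distinct [a, b, c, d]" and V: "pverts T1 = {a, b, c, d}"
    and cyc: "{(a, b), (b, c), (c, a)} \<subseteq> parcs T1"
    and dom: "{(d, a), (d, b), (d, c)} \<subseteq> parcs T1 \<or> {(a, d), (b, d), (c, d)} \<subseteq> parcs T1"
    using assms(2) by (auto simp: diamond_def)
  define P where "P x y z w \<longleftrightarrow> {(f x, f y), (f y, f z), (f z, f x)} \<subseteq> parcs T2 \<and>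
     ({(f w, f x), (f w, f y), (f w, f z)} \<subseteq> parcs T2 \<or>
      {(f x, f w), (f y, f w), (f z, f w)} \<subseteq> parcs T2)" for x y z w
  have P_diamond: "diamond T2" if "distinct [x, y, z, w]" "{x, y, z, w} = {a, b, c, d}" "P x y z w"
    for x y z w
  proof -
    have "distinct [f x, f y, f z, f w]"
      using that(1) inj_onD[OF D(5)] that(2) V by (auto simp: set_eq_iff)
    moreover have "pverts T2 = {f x, f y, f z, f w}" using D(4) V that(2)[symmetric] by auto
    ultimately show ?thesis using that(3) D(2) unfolding diamond_def P_def by blast
  qed
  have arcs: "(f x, f y) \<in> parcs T2 \<longleftrightarrow>
      (if x \<in> W \<longleftrightarrow> y \<in> W then (x, y) \<in> parcs T1 else (y, x) \<in> parcs T1)"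
    if "x \<in> {a, b, c, d}" "y \<in> {a, b, c, d}" for x y
    using D(6) that V by simp
  \<comment> \<open>The last argument of \<open>P\<close> is the apex. The disjuncts run over the
    four possible apices and the two orientations of the remaining triangle; the case split runs
    over all sign patterns.\<close>
  have "P a b c d \<or> P a c b d \<or> P a b d c \<or> P b a d c \<or> P a c d b \<or> P c a d b \<or> P b c d a \<or> P c b d a"
    using cyc dom
    by (cases "a \<in> W"; cases "b \<in> W"; cases "c \<in> W"; cases "d \<in> W") (auto simp: P_def arcs)
  then show ?thesis
    using dist by (elim disjE) (erule P_diamond[rotated 2]; auto)+
qed

section \<open>One-vertex extensions and CR tournaments\<close>

lemma tournament_extend:
  assumes "tournament T" "u \<notin> pverts T"
  shows "tournament (extend T u \<sigma>)"
proof (rule tournamentI)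
  fix x y assume "x \<in> pverts (extend T u \<sigma>)" "y \<in> pverts (extend T u \<sigma>)"
  then show "(x, y) \<in> parcs (extend T u \<sigma>) \<longleftrightarrow> x \<noteq> y \<and> (y, x) \<notin> parcs (extend T u \<sigma>)"
    using tournament_arc_iff[OF assms(1), of x y] tournament_parcs_subset[OF assms(1)] assms(2)
    by (cases "x = u"; cases "y = u") (auto simp: extend_def)
qed (use tournament_finite[OF assms(1)] tournament_parcs_subset[OF assms(1)] in
    \<open>auto simp: extend_def\<close>)

text \<open>The new vertex is given sign \<open>1\<close>, hence the removal of \<open>u1\<close>,
  which might lie in \<open>W\<close>. The range of \<open>\<sigma>\<close> matters:
  \<open>extend\<close> only tests for the value \<open>1\<close>, so negating
  \<open>\<sigma>\<close> reverses an arc only for values \<open>1\<close> and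
  \<open>-1\<close>.\<close>

lemma switching_map_extend:
  assumes m: "switching_map f W T1 T2" and u1: "u1 \<notin> pverts T1" and u2: "u2 \<notin> pverts T2"
    and \<tau>: "\<And>w. w \<in> pverts T1 \<Longrightarrow> \<tau> w = (if w \<in> W then - \<sigma> (f w) else \<sigma> (f w))"
    and \<sigma>: "\<sigma> \<in> pverts T2 \<rightarrow> {-1, 1}"
  shows "switching_map (f(u1 := u2)) (W - {u1}) (extend T1 u1 \<tau>) (extend T2 u2 \<sigma>)"
proof -
  note D = switching_mapD[OF m]
  have bij: "bij_betw (f(u1 := u2)) (insert u1 (pverts T1)) (insert u2 (pverts T2))"
    unfolding bij_betw_def inj_on_def
    using D(4) u1 u2 inj_onD[OF D(5)] by auto
  have fV: "f x \<in> pverts T2" "f x \<noteq> u2" if "x \<in> pverts T1" for x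
    using D(4) u2 that by auto
  have \<sigma>f: "\<sigma> (f x) = -1 \<or> \<sigma> (f x) = 1" if "x \<in> pverts T1" for x
    using \<sigma> fV(1)[OF that] by (auto simp: Pi_iff)
  have nin: "(u1, x) \<notin> parcs T1" "(x, u1) \<notin> parcs T1" "(u2, y) \<notin> parcs T2" "(y, u2) \<notin> parcs T2"
    for x y
    using tournament_parcs_subset[OF D(1)] tournament_parcs_subset[OF D(2)] u1 u2 by auto
  have "((f(u1 := u2)) x, (f(u1 := u2)) y) \<in> parcs (extend T2 u2 \<sigma>) \<longleftrightarrow>
      (if x \<in> W - {u1} \<longleftrightarrow> y \<in> W - {u1} then (x, y) \<in> parcs (extend T1 u1 \<tau>)
       else (y, x) \<in> parcs (extend T1 u1 \<tau>))"
    if "x \<in> insert u1 (pverts T1)" "y \<in> insert u1 (pverts T1)" for x y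
    using that \<sigma>f[of x] \<sigma>f[of y] fV[of x] fV[of y] u1 u2 D(6)[of x y]
    by (cases "x = u1"; cases "y = u1") (auto simp: extend_def nin \<tau>)
  then show ?thesis
    unfolding switching_map_def
    using tournament_extend[OF D(1) u1] tournament_extend[OF D(2) u2] bij
    by (simp add: extend_def)
qed

text \<open>The same \<open>k\<close> serves both tournaments. A non-CR extension of
  \<open>T2\<close> is pulled back to a non-CR extension of \<open>T1\<close>; the latter leaves
  \<open>det_class k\<close>, hence so does the former.\<close>

lemma switching_map_cr_tournament_imp:
  fixes T1 :: "'a::infinite pair_pre_digraph" and T2 :: "'b::infinite pair_pre_digraph"
  assumes m: "switching_map f W T1 T2" and cr: "cr_tournament T1"
  shows "cr_tournament T2"
proof -
  note D = switching_mapD[OF m]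
  obtain k where k: "odd k" "T1 \<in> det_class k - det_class (k - 2)"
    and alt: "card (pverts T1) = 1 \<or> card (pverts T1) = 2 \<or> diamond T1 \<or>
      (\<forall>u \<sigma>. u \<notin> pverts T1 \<longrightarrow> \<sigma> \<in> pverts T1 \<rightarrow> {-1, 1} \<longrightarrow>
         \<not> cr_vertex T1 u \<sigma> \<longrightarrow> extend T1 u \<sigma> \<notin> det_class k)"
    using cr unfolding cr_tournament_def by blast
  have card: "card (pverts T2) = card (pverts T1)"
    using bij_betw_same_card[OF D(3)] by simp
  have ext: "extend T2 u \<sigma> \<notin> det_class k"
    if H: "\<forall>u \<sigma>. u \<notin> pverts T1 \<longrightarrow> \<sigma> \<in> pverts T1 \<rightarrow> {-1, 1} \<longrightarrow>
         \<not> cr_vertex T1 u \<sigma> \<longrightarrow> extend T1 u \<sigma> \<notin> det_class k"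
      and u: "u \<notin> pverts T2" and \<sigma>: "\<sigma> \<in> pverts T2 \<rightarrow> {-1, 1}" and ncr: "\<not> cr_vertex T2 u \<sigma>"
    for u \<sigma>
  proof -
    \<comment> \<open>The given vertex \<open>u\<close> belongs to the other vertex type. A
      counterpart exists because the type of \<open>T1\<close> is infinite and \<open>T1\<close> is
      finite.\<close>
    obtain u1 where u1: "u1 \<notin> pverts T1"
      using tournament_finite[OF D(1)] infinite_UNIV ex_new_if_finite by blast
    define \<tau> where "\<tau> w = (if w \<in> W then - \<sigma> (f w) else \<sigma> (f w))" for w
    have \<tau>: "\<tau> \<in> pverts T1 \<rightarrow> {-1, 1}"
      using \<sigma> D(4) by (fastforce simp: \<tau>_def Pi_iff)
    note m' = switching_map_extend[OF m u1 u, of \<tau> \<sigma>, OF \<tau>_def \<sigma>]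
    have "cr_associated (extend T2 u \<sigma>) u (f w) \<longleftrightarrow> cr_associated (extend T1 u1 \<tau>) u1 w"
      if "w \<in> pverts T1" for w
    proof -
      have "w \<noteq> u1" using that u1 by auto
      then show ?thesis
        using switching_map_cr_associated[OF m', of u1 w] that by (simp add: extend_def)
    qed
    then have "\<not> cr_vertex T1 u1 \<tau>"
      using ncr D(4) by (auto simp: cr_vertex_def)
    with H u1 \<tau> have "extend T1 u1 \<tau> \<notin> det_class k" by blast
    then show ?thesis using switching_map_det_class[OF m'] by simp
  qed
  have "T2 \<in> det_class k - det_class (k - 2)"
    using k(2) switching_map_det_class[OF m] by simp
  then show ?thesis
    unfolding cr_tournament_def using k(1) alt ext switching_map_diamond[OF m] card by metis
qed

section \<open>1-transitive blowups and strong CR tournaments\<close>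

definition blowup_at :: "'a pair_pre_digraph \<Rightarrow> 'a \<Rightarrow> 'a \<Rightarrow> 'a \<Rightarrow> 'a pair_pre_digraph" where
  "blowup_at T v x y = \<lparr>pverts = (pverts T - {v}) \<union> {x, y},
     parcs = {(a, b). (a, b) \<in> parcs T \<and> a \<noteq> v \<and> b \<noteq> v} \<union> {(x, y)}
       \<union> {(z, w) | z w. z \<in> {x, y} \<and> (v, w) \<in> parcs T}
       \<union> {(w, z) | z w. z \<in> {x, y} \<and> (w, v) \<in> parcs T}\<rparr>"

lemma one_transitive_blowup_iff:
  "one_transitive_blowup T T' \<longleftrightarrow>
     (\<exists>v \<in> pverts T. \<exists>x y. x \<noteq> y \<and> x \<notin> pverts T - {v} \<and> y \<notin> pverts T - {v} \<and>
        T' = blowup_at T v x y)"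
  by (simp add: one_transitive_blowup_def blowup_at_def)

text \<open>Collapses the two copies back to the replaced vertex, which may itself be one of the
  copies.\<close>

definition blowup_proj :: "'a \<Rightarrow> 'a \<Rightarrow> 'a \<Rightarrow> 'a \<Rightarrow> 'a" where
  "blowup_proj v x y a = (if a = x \<or> a = y then v else a)"

text \<open>Apart from \<open>(x, y)\<close>, the arcs are the preimage of the arcs of
  \<open>T\<close> under the projection: pairs of copies project to the loop at \<open>v\<close>,
  which is no arc. This replaces the union of arc sets by one condition.\<close>

lemma blowup_at_arc_iff:
  assumes T: "tournament T" and v: "v \<in> pverts T" and xy: "x \<noteq> y"
    and x: "x \<notin> pverts T - {v}" and y: "y \<notin> pverts T - {v}"
    and a: "a \<in> pverts (blowup_at T v x y)" and b: "b \<in> pverts (blowup_at T v x y)"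
  shows "(a, b) \<in> parcs (blowup_at T v x y) \<longleftrightarrow>
    a = x \<and> b = y \<or> (blowup_proj v x y a, blowup_proj v x y b) \<in> parcs T"
proof -
  have sub: "p \<in> pverts T \<and> q \<in> pverts T \<and> p \<noteq> q" if "(p, q) \<in> parcs T" for p q
    using tournament_parcs_subset[OF T] tournament_no_loop[OF T] that by auto
  show ?thesis
    using a b x y xy by (auto simp: blowup_at_def blowup_proj_def dest: sub)
qed

lemma tournament_blowup_at:
  assumes T: "tournament T" and v: "v \<in> pverts T" and xy: "x \<noteq> y"
    and x: "x \<notin> pverts T - {v}" and y: "y \<notin> pverts T - {v}"
  shows "tournament (blowup_at T v x y)"
proof (rule tournamentI)
  show "finite (pverts (blowup_at T v x y))"
    using tournament_finite[OF T] by (simp add: blowup_at_def)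
  show "parcs (blowup_at T v x y) \<subseteq> pverts (blowup_at T v x y) \<times> pverts (blowup_at T v x y)"
    using tournament_parcs_subset[OF T] tournament_no_loop[OF T] by (auto simp: blowup_at_def)
  fix a b assume ab: "a \<in> pverts (blowup_at T v x y)" "b \<in> pverts (blowup_at T v x y)"
  have "blowup_proj v x y a \<in> pverts T" "blowup_proj v x y b \<in> pverts T"
    using ab v by (auto simp: blowup_at_def blowup_proj_def)
  note arc = tournament_arc_iff[OF T this]
  have eq: "blowup_proj v x y a = blowup_proj v x y b \<longleftrightarrow> a = b \<or> a \<in> {x, y} \<and> b \<in> {x, y}"
    using ab x y by (auto simp: blowup_at_def blowup_proj_def)
  show "(a, b) \<in> parcs (blowup_at T v x y) \<longleftrightarrow> a \<noteq> b \<and> (b, a) \<notin> parcs (blowup_at T v x y)"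
    unfolding blowup_at_arc_iff[OF assms ab] blowup_at_arc_iff[OF assms ab(2,1)]
    using arc eq xy tournament_no_loop[OF T] by (auto simp: blowup_proj_def)
qed

text \<open>The set of negative vertices is the preimage of \<open>W\<close> under the projection.
  The copies \<open>p\<close> and \<open>q\<close> are chosen outside \<open>T1\<close>, so updating
  \<open>f\<close> there leaves it intact on \<open>T1\<close>; \<open>x\<close> and
  \<open>y\<close> come from a given blowup and may reuse \<open>f v\<close>.\<close>

lemma switching_map_blowup_at:
  assumes m: "switching_map f W T1 T2" and v: "v \<in> pverts T1"
    and p: "p \<noteq> q" "p \<notin> pverts T1" "q \<notin> pverts T1"
    and x: "x \<noteq> y" "x \<notin> pverts T2 - {f v}" "y \<notin> pverts T2 - {f v}"
  shows "switching_map (f(p := x, q := y)) {a. blowup_proj v p q a \<in> W}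
    (blowup_at T1 v p q) (blowup_at T2 (f v) x y)"
proof -
  note D = switching_mapD[OF m]
  let ?B1 = "blowup_at T1 v p q" and ?B2 = "blowup_at T2 (f v) x y" and ?g = "f(p := x, q := y)"
  have fv: "f v \<in> pverts T2" using D(4) v by auto
  have p': "p \<notin> pverts T1 - {v}" "q \<notin> pverts T1 - {v}" using p by auto
  note arc1 = blowup_at_arc_iff[OF D(1) v p(1) p']
  note arc2 = blowup_at_arc_iff[OF D(2) fv x]
  have V1: "pverts ?B1 = insert p (insert q (pverts T1 - {v}))" by (auto simp: blowup_at_def)
  have V2: "pverts ?B2 = insert x (insert y (pverts T2 - {f v}))" by (auto simp: blowup_at_def)
  have im: "f ` (pverts T1 - {v}) = pverts T2 - {f v}"
    using D(4,5) v by (auto dest: inj_onD)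
  have fx: "f a \<noteq> x" "f a \<noteq> y" if "a \<in> pverts T1 - {v}" for a
    using im that x by auto
  have im': "?g ` (pverts T1 - {v}) = pverts T2 - {f v}"
    using p by (subst im[symmetric], intro image_cong) auto
  have bij: "bij_betw ?g (pverts ?B1) (pverts ?B2)"
    unfolding bij_betw_def
  proof
    show "?g ` pverts ?B1 = pverts ?B2" unfolding V1 V2 image_insert im' using p(1) by simp
    show "inj_on ?g (pverts ?B1)"
      unfolding V1 inj_on_def using inj_onD[OF D(5)] fx p x(1) by (auto dest: fx)
  qed
  \<comment> \<open>The two projections commute with the vertex maps, which reduces the arc
    condition to the one for \<open>f\<close>.\<close>
  have proj: "blowup_proj (f v) x y (?g a) = f (blowup_proj v p q a)" if "a \<in> pverts ?B1" for a
    using that fx[of a] by (auto simp: V1 blowup_proj_def)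
  have proj_in: "blowup_proj v p q a \<in> pverts T1" if "a \<in> pverts ?B1" for a
    using that v by (auto simp: V1 blowup_proj_def)
  have gx: "?g a = x \<longleftrightarrow> a = p" "?g a = y \<longleftrightarrow> a = q" if "a \<in> pverts ?B1" for a
    using that fx[of a] p(1) x(1) by (auto simp: V1)
  have "(?g a, ?g b) \<in> parcs ?B2 \<longleftrightarrow>
      (if a \<in> {a. blowup_proj v p q a \<in> W} \<longleftrightarrow> b \<in> {a. blowup_proj v p q a \<in> W}
       then (a, b) \<in> parcs ?B1 else (b, a) \<in> parcs ?B1)"
    if ab: "a \<in> pverts ?B1" "b \<in> pverts ?B1" for a b
  proof -
    have "?g a \<in> pverts ?B2" "?g b \<in> pverts ?B2" using bij_betw_apply[OF bij] ab by blast+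
    then have "(?g a, ?g b) \<in> parcs ?B2 \<longleftrightarrow> a = p \<and> b = q \<or>
        (f (blowup_proj v p q a), f (blowup_proj v p q b)) \<in> parcs T2"
      using arc2 by (simp only: proj[OF ab(1)] proj[OF ab(2)] gx[OF ab(1)] gx[OF ab(2)])
    \<comment> \<open>Both copies have the sign of \<open>v\<close>, so the arc from
      \<open>p\<close> to \<open>q\<close> is not reversed and matches the arc from \<open>x\<close>
      to \<open>y\<close>.\<close>
    then show ?thesis
      unfolding arc1[OF ab] arc1[OF ab(2,1)] D(6)[OF proj_in[OF ab(1)] proj_in[OF ab(2)]]
      using tournament_no_loop[OF D(1)] by (auto simp: blowup_proj_def)
  qed
  then show ?thesis
    unfolding switching_map_def
    using bij tournament_blowup_at[OF D(1) v p(1) p'] tournament_blowup_at[OF D(2) fv x] by blast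
qed

lemma switching_map_strong_cr_tournament_imp:
  fixes T1 :: "'a::infinite pair_pre_digraph" and T2 :: "'b::infinite pair_pre_digraph"
  assumes m: "switching_map f W T1 T2" and s: "strong_cr_tournament T1"
  shows "strong_cr_tournament T2"
proof -
  note D = switching_mapD[OF m]
  have "cr_tournament T'" if T': "one_transitive_blowup T2 T'" for T'
  proof -
    obtain v' x y where v': "v' \<in> pverts T2"
      and x: "x \<noteq> y" "x \<notin> pverts T2 - {v'}" "y \<notin> pverts T2 - {v'}"
      and eq: "T' = blowup_at T2 v' x y"
      using T' unfolding one_transitive_blowup_iff by blast
    obtain v where v: "v \<in> pverts T1" "v' = f v" using v' D(4) by blast
    obtain p where p: "p \<notin> pverts T1"
      using tournament_finite[OF D(1)] infinite_UNIV ex_new_if_finite by blast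
    obtain q where "q \<notin> insert p (pverts T1)"
      using tournament_finite[OF D(1)] infinite_UNIV ex_new_if_finite finite_insert by metis
    then have q: "p \<noteq> q" "q \<notin> pverts T1" by auto
    \<comment> \<open>Blowing up the preimage \<open>v\<close> of the replaced vertex gives the
      counterpart of \<open>T'\<close> to which the strong hypothesis on \<open>T1\<close>
      applies.\<close>
    have "one_transitive_blowup T1 (blowup_at T1 v p q)"
      unfolding one_transitive_blowup_iff using v(1) p q by blast
    then have "cr_tournament (blowup_at T1 v p q)"
      using s by (simp add: strong_cr_tournament_def)
    then show ?thesis
      using switching_map_cr_tournament_imp[OF switching_map_blowup_at[OF m v(1) q(1) p q(2)]]
        x eq v(2) by blast
  qed
  then show ?thesis
    using s switching_map_cr_tournament_imp[OF m] by (simp add: strong_cr_tournament_def)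
qed

section \<open>Basic tournaments and the five equivalences\<close>

lemma switching_map_basic_tournament:
  assumes m: "switching_map f W T1 T2"
  shows "basic_tournament T2 \<longleftrightarrow> basic_tournament T1"
proof -
  note D = switching_mapD[OF m]
  have card: "card (pverts T2) = card (pverts T1)"
    using bij_betw_same_card[OF D(3)] by simp
  have "(\<exists>u \<in> pverts T2. \<exists>v \<in> pverts T2. u \<noteq> v \<and> cr_associated T2 u v) \<longleftrightarrow>
      (\<exists>u \<in> pverts T1. \<exists>v \<in> pverts T1. u \<noteq> v \<and> cr_associated T1 u v)"
    \<comment> \<open>Writing the vertices of \<open>T2\<close> as images under \<open>f\<close>
      turns both quantifiers into quantifiers over \<open>T1\<close>; injectivity takes care of
      \<open>u \<noteq> v\<close>.\<close>
    unfolding D(4)[symmetric] bex_simps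
    using switching_map_cr_associated[OF m] D(5) by (metis inj_on_eq_iff)
  then show ?thesis using D(1,2) card by (simp add: basic_tournament_def)
qed

theorem theorem4p6:
  fixes T1 :: "'a::infinite pair_pre_digraph" and T2 :: "'b::infinite pair_pre_digraph"
  assumes "tournament T1" and "tournament T2"
    and "switching_isomorphic T1 T2"
  shows "(cr_tournament T1 \<longleftrightarrow> cr_tournament T2) \<and>
    (strong_cr_tournament T1 \<longleftrightarrow> strong_cr_tournament T2) \<and>
    (basic_tournament T1 \<longleftrightarrow> basic_tournament T2) \<and>
    (basic_cr_tournament T1 \<longleftrightarrow> basic_cr_tournament T2) \<and>
    (basic_strong_cr_tournament T1 \<longleftrightarrow> basic_strong_cr_tournament T2)"
proof -
  obtain f W where m: "switching_map f W T1 T2"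
    using switching_isomorphic_imp_switching_map[OF assms] .
  \<comment> \<open>The transfer lemmas for CR and strong CR tournaments are implications between
    arbitrary infinite vertex types, so the inverse map supplies their converses.\<close>
  note m' = switching_map_inverse[OF m]
  have "cr_tournament T1 \<longleftrightarrow> cr_tournament T2"
    using switching_map_cr_tournament_imp[OF m] switching_map_cr_tournament_imp[OF m'] by blast
  moreover have "strong_cr_tournament T1 \<longleftrightarrow> strong_cr_tournament T2"
    using switching_map_strong_cr_tournament_imp[OF m] switching_map_strong_cr_tournament_imp[OF m']
    by blast
  moreover have "basic_tournament T1 \<longleftrightarrow> basic_tournament T2"
    using switching_map_basic_tournament[OF m] by simp
  ultimately show ?thesis
    by (simp add: basic_cr_tournament_def basic_strong_cr_tournament_def)
qed

end
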